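(* Let $\alpha>-5/6$ and $\lambda=\frac12(6\alpha+5)>0$. Define the family of polynomials $P_{p,q}=P^{(\alpha)}_{p,q}(Z,\bar Z)$, $(p,q)\in\mathbb{N}^2$, by induction from $P_{0,0}=1$, $P_{0,1}=\bar Z$, $P_{1,0}=Z$ and $$P_{p+1,q}=Z P_{p,q}+a_1(\lambda,p)P_{p-1,q+1}+a_2(\lambda,p,q)P_{p,q-1},$$ $$P_{p,q+1}=\bar Z P_{p,q}+a_1(\lambda,q)P_{p+1,q-1}+a_2(\lambda,q,p)P_{p-1,q},$$ where $$a_1(\lambda,p)=-\frac{p(3p+2\lambda-5)}{(\lambda+3p-1)(\lambda+3p-4)},$$ $$a_2(\lambda,p,q)=-\frac{q(3q+2\lambda-5)(\lambda+3(p+q)-1)(\lambda+p+q-2)}{(\lambda+3q-1)(2\lambda+3(p+q)-5)(2\lambda+3(p+q)-2)(\lambda+3q-4)}.$$ Then $$L^{(\alpha)}P_{p,q}=-\lambda_{p,q}P_{p,q},\qquad \lambda_{p,q}=(\lambda-1)(p+q)+p^2+q^2+pq .$$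
   Context: $\mathbb{N}=\{0,1,2,\dots\}$. $Z$ and $\bar Z$ are treated as two independent variables (conjugate complex coordinates on the plane), and $L^{(\alpha)}$ acts on polynomials in $(Z,\bar Z)$ by $$L^{(\alpha)}=(\bar Z-Z^2)\partial_Z^2+(1-Z\bar Z)\partial_Z\partial_{\bar Z}+(Z-\bar Z^2)\partial_{\bar Z}^2-\lambda\,(Z\partial_Z+\bar Z\partial_{\bar Z}),\qquad \lambda=\tfrac12(6\alpha+5).$$ Convention: $a_1(\lambda,0)=a_2(\lambda,p,0)=0$, so that terms with a negative index do not appear; whenever a denominator vanishes at the given value of $\lambda$, $a_1(\lambda,p)$ and $a_2(\lambda,p,q)$ are replaced by $\lim_{\epsilon\to0}a_1(\lambda+\epsilon,p)$ and $\lim_{\epsilon\to 0}a_2(\lambda+\epsilon,p,q)$. *)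

theory Defs
  imports Complex_Main "HOL-Computational_Algebra.Polynomial"
begin

text \<open>Polynomials in the independent variables Z and Zb (the conjugate of Z) have type
  \<^typ>\<open>real poly poly\<close>: the outer variable is Z, the inner one is Zb.\<close>

definition Z :: "real poly poly" where
  "Z = [:0, 1:]"

definition Zb :: "real poly poly" where
  "Zb = [:[:0, 1:]:]"

definition dZ :: "real poly poly \<Rightarrow> real poly poly" where
  "dZ f = pderiv f"

definition dZb :: "real poly poly \<Rightarrow> real poly poly" where
  "dZb f = map_poly pderiv f"

definition scale :: "real \<Rightarrow> real poly poly \<Rightarrow> real poly poly" where
  "scale c f = smult [:c:] f"

definition lam :: "real \<Rightarrow> real" where
  "lam \<alpha> = (6 * \<alpha> + 5) / 2"

definition L :: "real \<Rightarrow> real poly poly \<Rightarrow> real poly poly" where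
  "L \<alpha> f =
     (Zb - Z ^ 2) * dZ (dZ f) + (1 - Z * Zb) * dZ (dZb f) + (Z - Zb ^ 2) * dZb (dZb f)
     - scale (lam \<alpha>) (Z * dZ f + Zb * dZb f)"

definition a1_num :: "real \<Rightarrow> nat \<Rightarrow> real" where
  "a1_num l p = - (real p * (3 * real p + 2 * l - 5))"

definition a1_den :: "real \<Rightarrow> nat \<Rightarrow> real" where
  "a1_den l p = (l + 3 * real p - 1) * (l + 3 * real p - 4)"

definition a2_num :: "real \<Rightarrow> nat \<Rightarrow> nat \<Rightarrow> real" where
  "a2_num l p q =
     - (real q * (3 * real q + 2 * l - 5) * (l + 3 * (real p + real q) - 1)
        * (l + real p + real q - 2))"

definition a2_den :: "real \<Rightarrow> nat \<Rightarrow> nat \<Rightarrow> real" where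
  "a2_den l p q =
     (l + 3 * real q - 1) * (2 * l + 3 * (real p + real q) - 5)
     * (2 * l + 3 * (real p + real q) - 2) * (l + 3 * real q - 4)"

definition a1 :: "real \<Rightarrow> nat \<Rightarrow> real" where
  "a1 l p =
     (if p = 0 then 0
      else if a1_den l p = 0 then Lim (at 0) (\<lambda>\<epsilon>. a1_num (l + \<epsilon>) p / a1_den (l + \<epsilon>) p)
      else a1_num l p / a1_den l p)"

definition a2 :: "real \<Rightarrow> nat \<Rightarrow> nat \<Rightarrow> real" where
  "a2 l p q =
     (if q = 0 then 0
      else if a2_den l p q = 0
        then Lim (at 0) (\<lambda>\<epsilon>. a2_num (l + \<epsilon>) p q / a2_den (l + \<epsilon>) p q)
      else a2_num l p q / a2_den l p q)"

text \<open>At index 0 the truncated subtractions below only occur multiplied by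
  \<^term>\<open>a1 l 0\<close> or \<^term>\<open>a2 l p 0\<close>, which are 0.
  The two recurrences overlap (both constrain \<^term>\<open>P (p + 1) (q + 1)\<close>), so this is a
  predicate on families rather than a recursive function.\<close>

definition recurrence_family :: "real \<Rightarrow> (nat \<Rightarrow> nat \<Rightarrow> real poly poly) \<Rightarrow> bool" where
  "recurrence_family l P \<longleftrightarrow>
     P 0 0 = 1 \<and> P 0 1 = Zb \<and> P 1 0 = Z \<and>
     (\<forall>p q. P (p + 1) q =
        Z * P p q + scale (a1 l p) (P (p - 1) (q + 1)) + scale (a2 l p q) (P p (q - 1))) \<and>
     (\<forall>p q. P p (q + 1) =
        Zb * P p q + scale (a1 l q) (P (p + 1) (q - 1)) + scale (a2 l q p) (P (p - 1) q))"

definition eigval :: "real \<Rightarrow> nat \<Rightarrow> nat \<Rightarrow> real" where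
  "eigval l p q =
     (l - 1) * (real p + real q) + real p ^ 2 + real q ^ 2 + real p * real q"

end

theory Submission
  imports Defs
begin

text \<open>
  The coefficients factor as a2(p, q) = a1(q) h(p + q), and a1 and h satisfy first-order
  inhomogeneous recurrences in which no limit is needed. Let A = [L, Z] and B = [L, Zb], which are
  first-order differential operators. The point is that A and B act on the family by three-term
  formulas: if Z P(p, q) = P(p+1, q) - a1(p) P(p-1, q+1) - a2(p, q) P(p, q-1), then A P(p, q) is the
  same combination with each term multiplied by the difference of its (conjectured) L-eigenvalue and
  that of P(p, q). Since [A, Z] and [A, Zb] are multiplication operators, these formulas propagate
  along the recurrences by induction on the degree, and the eigenvalue equation follows from
  L (Z f) = Z L f + A f and L (Zb f) = Zb L f + B f. Existence amounts to the compatibility of the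
  two recurrences at (p+1, q+1), which again reduces by induction on the degree to an identity
  between the coefficients.
\<close>

section \<open>The recurrences over a commutative ring\<close>

text \<open>Scalars and polynomials share one ring here, so that all later steps are ring
  identities; denominators are multiplied out. \<open>a p\<close> stands for a1,
  \<open>h (p + q)\<close> for the quotient of a2 by a1. \<open>a_h\<close> is what compatibility of
  the recurrences demands, \<open>a_h_0\<close> what is left when the formula for A is pushed along
  p = 0. \<open>h_Suc\<close> starts at n = 1 because the denominator of the closed form used for
  \<open>h 0\<close> vanishes at l = 1 and l = 5/2.\<close>

locale deltoid_coeffs =
  fixes l :: "'a::comm_ring_1" and a h :: "nat \<Rightarrow> 'a"
  assumes a_0: "a 0 = 0"
    and a_Suc: "(l + 3 * of_nat p + 2) * a (Suc p) + 2 = (l + 3 * of_nat p - 4) * a p"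
    and h_Suc: "n > 0 \<Longrightarrow>
      (2 * l + 3 * of_nat n + 1) * h (Suc n) = 2 + (2 * l + 3 * of_nat n - 5) * h n"
    and a_h: "a q * h (p + q) + a (Suc p) * h (Suc (p + q)) - a p * a (Suc q)
      = a p * h (p + q) + a (Suc q) * h (Suc (p + q)) - a q * a (Suc p)"
    and a_h_0: "1 + (l + of_nat q) * a 1 * h (Suc q)
      + a q * (h q * (2 - l - 2 * of_nat q) + a 1 * (of_nat q - 2))
      + a (Suc q) * h (Suc q) * (1 + l + 2 * of_nat q) = 0"

locale deltoid_recurrence = deltoid_coeffs l a h
  for l :: "'a::comm_ring_1" and a h :: "nat \<Rightarrow> 'a" +
  fixes x y :: 'a
begin

section \<open>Compatibility of the two recurrences, existence and uniqueness of the family\<close>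

definition rec_x :: "(nat \<Rightarrow> nat \<Rightarrow> 'a) \<Rightarrow> nat \<Rightarrow> nat \<Rightarrow> bool" where
  "rec_x P p q \<longleftrightarrow>
     P (Suc p) q = x * P p q + a p * P (p - 1) (Suc q) + a q * h (p + q) * P p (q - 1)"

definition rec_y :: "(nat \<Rightarrow> nat \<Rightarrow> 'a) \<Rightarrow> nat \<Rightarrow> nat \<Rightarrow> bool" where
  "rec_y P p q \<longleftrightarrow>
     P p (Suc q) = y * P p q + a q * P (Suc p) (q - 1) + a p * h (p + q) * P (p - 1) q"

definition family :: "(nat \<Rightarrow> nat \<Rightarrow> 'a) \<Rightarrow> bool" where
  "family P \<longleftrightarrow> P 0 0 = 1 \<and> (\<forall>p q. rec_x P p q \<and> rec_y P p q)"

text \<open>Expand x P(p, q+1) and y P(p+1, q): since x and y commute, the recurrences of degree at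
  most p + q cancel everything except a multiple of P(p, q), and its coefficient vanishes by
  \<open>a_h\<close>.\<close>

lemma rec_x_y_compatible:
  assumes x: "\<And>i j. i + j \<le> p + q \<Longrightarrow> rec_x P i j"
    and y: "\<And>i j. i + j \<le> p + q \<Longrightarrow> rec_y P i j"
    and x': "rec_x P p (Suc q)"
  shows "rec_y P (Suc p) q"
proof -
  have 1: "P (Suc p) q - (x * P p q + a p * P (p - 1) (Suc q) + a q * h (p + q) * P p (q - 1)) = 0"
    (is "?e1 = 0")
    using x[of p q] by (simp add: rec_x_def)
  have 2: "P p (Suc q) - (y * P p q + a q * P (Suc p) (q - 1) + a p * h (p + q) * P (p - 1) q) = 0"
    (is "?e2 = 0")
    using y[of p q] by (simp add: rec_y_def)
  \<comment> \<open>The factor \<open>a p\<close>, and likewise \<open>a q\<close> below, kills the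
    equation at p = 0 or q = 0, where the predecessor is truncated.\<close>
  have 3: "a p * P (p - 1) (Suc (Suc q)) - a p * (y * P (p - 1) (Suc q) + a (Suc q) * P p q
      + a (p - 1) * h (p + q) * P (p - 2) (Suc q)) = 0" (is "?e3 = 0")
    using y[of "p - 1" "Suc q"] by (cases p) (auto simp: a_0 rec_y_def numeral_2_eq_2)
  have 4: "a q * P p q - a q * (y * P p (q - 1) + a (q - 1) * P (Suc p) (q - 2)
      + a p * h (p + q - 1) * P (p - 1) (q - 1)) = 0" (is "?e4 = 0")
    using y[of p "q - 1"] by (cases q) (auto simp: a_0 rec_y_def numeral_2_eq_2)
  have 5: "a q * P (Suc (Suc p)) (q - 1) - a q * (x * P (Suc p) (q - 1) + a (Suc p) * P p q
      + a (q - 1) * h (p + q) * P (Suc p) (q - 2)) = 0" (is "?e5 = 0")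
    using x[of "Suc p" "q - 1"] by (cases q) (auto simp: a_0 rec_x_def numeral_2_eq_2)
  have 6: "a p * P p q - a p * (x * P (p - 1) q + a (p - 1) * P (p - 2) (Suc q)
      + a q * h (p + q - 1) * P (p - 1) (q - 1)) = 0" (is "?e6 = 0")
    using x[of "p - 1" q] by (cases p) (auto simp: a_0 rec_x_def numeral_2_eq_2)
  have 7: "P (Suc p) (Suc q) - (x * P p (Suc q) + a p * P (p - 1) (Suc (Suc q))
      + a (Suc q) * h (Suc (p + q)) * P p q) = 0" (is "?e7 = 0")
    using x' by (simp add: rec_x_def)
  have 8: "a q * h (p + q) + a (Suc p) * h (Suc (p + q)) - a p * a (Suc q)
      - (a p * h (p + q) + a (Suc q) * h (Suc (p + q)) - a q * a (Suc p)) = 0" (is "?e8 = 0")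
    using a_h[of q p] by simp
  \<comment> \<open>The defect of the y-recurrence at (p+1, q), written as an explicit combination
    of the vanishing expressions above.\<close>
  have "P (Suc p) (Suc q) - (y * P (Suc p) q + a q * P (Suc (Suc p)) (q - 1)
      + a (Suc p) * h (Suc (p + q)) * P p q)
    = ?e7 + x * ?e2 + ?e3 - y * ?e1 - ?e5 + h (p + q) * ?e4 - h (p + q) * ?e6 - P p q * ?e8"
    by (simp add: algebra_simps)
  also have "\<dots> = 0"
    unfolding 1 2 3 4 5 6 7 8 by simp
  finally show ?thesis
    by (simp add: rec_y_def)
qed

text \<open>Every recursive call is at strictly smaller total degree; the case distinctions exclude the
  truncated indices, at which this would fail.\<close>

function fam :: "nat \<Rightarrow> nat \<Rightarrow> 'a" where
  "fam (Suc p) q = x * fam p q + (if p = 0 then 0 else a p * fam (p - 1) (Suc q))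
     + (if q = 0 then 0 else a q * h (p + q) * fam p (q - 1))"
| "fam 0 (Suc q) = y * fam 0 q + (if q = 0 then 0 else a q * fam 1 (q - 1))"
| "fam 0 0 = 1"
  by pat_completeness auto
termination
  by (relation "measure (\<lambda>(p, q). p + q)") auto

lemma rec_x_fam: "rec_x fam p q"
  by (auto simp: rec_x_def a_0)

text \<open>The y-recurrence is built into \<open>fam\<close> only for p = 0; for p > 0 it is
  inherited from smaller total degree by compatibility with the x-recurrence.\<close>

lemma rec_y_fam: "rec_y fam p q"
proof (induction "p + q" arbitrary: p q rule: less_induct)
  case less
  show ?case
  proof (cases p)
    case 0
    then show ?thesis
      by (auto simp: rec_y_def a_0)
  next
    case (Suc r)
    then show ?thesis
      using less by (auto intro: rec_x_y_compatible rec_x_fam)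
  qed
qed

lemma family_fam: "family fam"
  by (simp add: family_def rec_x_fam rec_y_fam)

lemma family_unique:
  assumes "family P"
  shows "P p q = fam p q"
proof (induction p q rule: fam.induct)
  case (1 p q)
  have "P (Suc p) q = x * P p q + a p * P (p - 1) (Suc q) + a q * h (p + q) * P p (q - 1)"
    using assms by (simp add: family_def rec_x_def)
  then show ?case
    using 1 by (auto simp: a_0)
next
  case (2 q)
  have "P 0 (Suc q) = y * P 0 q + a q * P (Suc 0) (q - 1)"
    using assms by (simp add: family_def rec_y_def a_0)
  then show ?case
    using 2 by (auto simp: a_0)
next
  case 3
  then show ?case
    using assms by (simp add: family_def)
qed

section \<open>Commutator formulas and the eigenvalue equation\<close>

text \<open>The abstract ring has no designated field of scalars, so homogeneity is required for
  exactly the coefficients that occur in the recurrences.\<close>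

definition lin_op :: "('a \<Rightarrow> 'a) \<Rightarrow> bool" where
  "lin_op F \<longleftrightarrow> (\<forall>f g. F (f + g) = F f + F g) \<and> (\<forall>n f. F (a n * f) = a n * F f)
     \<and> (\<forall>n f. F (h n * f) = h n * F f)"

end

text \<open>A and B play the commutators of L with multiplication by x and y. The axioms are
  invariant under exchanging x with y and A with B.\<close>

locale deltoid_ops = deltoid_recurrence l a h x y
  for l :: "'a::comm_ring_1" and a h :: "nat \<Rightarrow> 'a" and x y :: 'a +
  fixes L A B :: "'a \<Rightarrow> 'a"
  assumes lin: "lin_op L" "lin_op A" "lin_op B"
    and L_1: "L 1 = 0" and A_1: "A 1 = - l * x" and B_1: "B 1 = - l * y"
    and L_x: "L (x * f) = x * L f + A f"
    and L_y: "L (y * f) = y * L f + B f"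
    and A_x: "A (x * f) = x * A f + 2 * (y - x * x) * f"
    and A_y: "A (y * f) = y * A f + (1 - x * y) * f"
    and B_x: "B (x * f) = x * B f + (1 - x * y) * f"
    and B_y: "B (y * f) = y * B f + 2 * (x - y * y) * f"
begin

text \<open>The factors other than \<open>a p\<close> and \<open>a q * h (p + q)\<close> are differences of the eigenvalues
  \<open>eig\<close> below.\<close>

definition A_rel :: "(nat \<Rightarrow> nat \<Rightarrow> 'a) \<Rightarrow> nat \<Rightarrow> nat \<Rightarrow> bool" where
  "A_rel P p q \<longleftrightarrow> A (P p q) = - (l + 2 * of_nat p + of_nat q) * P (Suc p) q
     + a p * (1 - of_nat p + of_nat q) * P (p - 1) (Suc q)
     + a q * h (p + q) * (2 - l - of_nat p - 2 * of_nat q) * P p (q - 1)"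

text \<open>Apply A to the x-recurrence and use the formula at the three terms of degree at most p +
  q. The leftover multiples of P(p, q+1), P(p-1, q) and P(p+1, q-1) vanish by \<open>a_Suc\<close>
  at p, \<open>a_Suc\<close> at q and \<open>h_Suc\<close>.\<close>

lemma A_rel_Suc_left:
  assumes P: "family P" and IH: "\<And>i j. i + j \<le> p + q \<Longrightarrow> A_rel P i j"
  shows "A_rel P (Suc p) q"
proof -
  have x: "rec_x P i j" and y: "rec_y P i j" for i j
    using P by (auto simp: family_def)
  let ?p = "of_nat p :: 'a" and ?q = "of_nat q :: 'a" and ?h = "h (p + q)"
  have 1: "A (P p q) - (- (l + 2 * ?p + ?q) * P (Suc p) q + a p * (1 - ?p + ?q) * P (p - 1) (Suc q)
      + a q * ?h * (2 - l - ?p - 2 * ?q) * P p (q - 1)) = 0" (is "?e1 = 0")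
    using IH[of p q] by (simp add: A_rel_def)
  have 2: "P (Suc p) q - (x * P p q + a p * P (p - 1) (Suc q) + a q * ?h * P p (q - 1)) = 0"
    (is "?e2 = 0")
    using x[of p q] by (simp add: rec_x_def)
  have 3: "a p * A (P (p - 1) (Suc q)) - a p * (- (l + 2 * ?p + ?q - 1) * P p (Suc q)
      + a (p - 1) * (3 - ?p + ?q) * P (p - 2) (Suc (Suc q))
      + a (Suc q) * ?h * (1 - l - ?p - 2 * ?q) * P (p - 1) q) = 0" (is "?e3 = 0")
    by (cases p) (simp_all add: a_0 IH[unfolded A_rel_def] numeral_2_eq_2 algebra_simps)
  have 4: "a q * A (P p (q - 1)) - a q * (- (l + 2 * ?p + ?q - 1) * P (Suc p) (q - 1)
      + a p * (?q - ?p) * P (p - 1) q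
      + a (q - 1) * h (p + q - 1) * (4 - l - ?p - 2 * ?q) * P p (q - 2)) = 0" (is "?e4 = 0")
    by (cases q) (simp_all add: a_0 IH[unfolded A_rel_def] numeral_2_eq_2 algebra_simps)
  have 5: "P (Suc (Suc p)) q - (x * P (Suc p) q + a (Suc p) * P p (Suc q)
      + a q * h (Suc (p + q)) * P (Suc p) (q - 1)) = 0" (is "?e5 = 0")
    using x[of "Suc p" q] by (simp add: rec_x_def)
  have 6: "a p * P p (Suc q) - a p * (x * P (p - 1) (Suc q)
      + a (p - 1) * P (p - 2) (Suc (Suc q)) + a (Suc q) * ?h * P (p - 1) q) = 0" (is "?e6 = 0")
    using x[of "p - 1" "Suc q"] by (cases p) (auto simp: a_0 rec_x_def numeral_2_eq_2)
  have 7: "a q * P (Suc p) (q - 1) - a q * (x * P p (q - 1) + a p * P (p - 1) q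
      + a (q - 1) * h (p + q - 1) * P p (q - 2)) = 0" (is "?e7 = 0")
    using x[of p "q - 1"] by (cases q) (auto simp: a_0 rec_x_def numeral_2_eq_2)
  have 8: "P p (Suc q) - (y * P p q + a q * P (Suc p) (q - 1) + a p * ?h * P (p - 1) q) = 0"
    (is "?e8 = 0")
    using y[of p q] by (simp add: rec_y_def)
  have "A (P (Suc p) q) = A (x * P p q + a p * P (p - 1) (Suc q) + a q * (?h * P p (q - 1)))"
    using x[of p q] by (simp add: rec_x_def mult.assoc)
  then have 9: "A (P (Suc p) q) - (x * A (P p q) + 2 * (y - x * x) * P p q
      + a p * A (P (p - 1) (Suc q)) + a q * ?h * A (P p (q - 1))) = 0" (is "?e9 = 0")
    using lin(2) by (simp add: lin_op_def A_x mult.assoc)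
  have 10: "(l + 3 * ?p + 2) * a (Suc p) + 2 - (l + 3 * ?p - 4) * a p = 0" (is "?e10 = 0")
    using a_Suc[of p] by simp
  have 11: "(l + 3 * ?q + 2) * a (Suc q) + 2 - (l + 3 * ?q - 4) * a q = 0" (is "?e11 = 0")
    using a_Suc[of q] by simp
  \<comment> \<open>The factor \<open>a q\<close> covers p + q = 0, where \<open>h_Suc\<close> does
    not apply but \<open>a 0 = 0\<close>.\<close>
  have 12: "a q * ((2 * l + 3 * (?p + ?q) + 1) * h (Suc (p + q)))
      - a q * (2 + (2 * l + 3 * (?p + ?q) - 5) * ?h) = 0" (is "?e12 = 0")
    using h_Suc[of "p + q"] by (cases q) (auto simp: a_0)
  have "A (P (Suc p) q) - (- (l + 2 * (?p + 1) + ?q) * P (Suc (Suc p)) q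
      + a (Suc p) * (?q - ?p) * P p (Suc q)
      + a q * h (Suc (p + q)) * (1 - l - ?p - 2 * ?q) * P (Suc p) (q - 1))
    = ?e9 + x * ?e1 + ?e3 + ?h * ?e4 - 2 * ?e8 + 2 * x * ?e2 + (l + 2 * ?p + ?q + 2) * ?e5
      - (3 - ?p + ?q) * ?e6 - (4 - l - ?p - 2 * ?q) * ?h * ?e7
      + P p (Suc q) * ?e10 - a p * ?h * P (p - 1) q * ?e11 + P (Suc p) (q - 1) * ?e12"
    by (simp add: algebra_simps)
  also have "\<dots> = 0"
    unfolding 1 2 3 4 5 6 7 8 9 10 11 12 by simp
  finally show ?thesis
    by (simp add: A_rel_def algebra_simps)
qed

text \<open>The x-recurrence never produces P(0, q+1), so A is moved past y instead. The terms left
  over are multiples of P(0, q) and cancel by \<open>a_h_0\<close>.\<close>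

lemma A_rel_0_Suc:
  assumes P: "family P" and IH: "\<And>i j. i + j \<le> q \<Longrightarrow> A_rel P i j"
  shows "A_rel P 0 (Suc q)"
proof -
  have x: "rec_x P i j" and y: "rec_y P i j" for i j
    using P by (auto simp: family_def)
  let ?q = "of_nat q :: 'a" and ?h = "h q"
  have 1: "A (P 0 q) - (- (l + ?q) * P 1 q + a q * ?h * (2 - l - 2 * ?q) * P 0 (q - 1)) = 0"
    (is "?e1 = 0")
    using IH[of 0 q] by (simp add: A_rel_def a_0)
  have 2: "a q * A (P 1 (q - 1)) - a q * (- (l + 1 + ?q) * P 2 (q - 1) + a 1 * (?q - 1) * P 0 q
      + a (q - 1) * ?h * (3 - l - 2 * ?q) * P 1 (q - 2)) = 0" (is "?e2 = 0")
    by (cases q) (simp_all add: a_0 IH[unfolded A_rel_def] numeral_2_eq_2 algebra_simps)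
  have 3: "P 1 (Suc q) - (y * P 1 q + a q * P 2 (q - 1) + a 1 * h (Suc q) * P 0 q) = 0"
    (is "?e3 = 0")
    using y[of 1 q] by (simp add: rec_y_def numeral_2_eq_2)
  have 4: "a q * P 0 q - a q * (y * P 0 (q - 1) + a (q - 1) * P 1 (q - 2)) = 0" (is "?e4 = 0")
    using y[of 0 "q - 1"] by (cases q) (auto simp: a_0 rec_y_def numeral_2_eq_2)
  have 5: "P 0 (Suc q) - (y * P 0 q + a q * P 1 (q - 1)) = 0" (is "?e5 = 0")
    using y[of 0 q] by (simp add: rec_y_def a_0)
  have 6: "P 1 (Suc q) - (x * P 0 (Suc q) + a (Suc q) * h (Suc q) * P 0 q) = 0" (is "?e6 = 0")
    using x[of 0 "Suc q"] by (simp add: rec_x_def a_0)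
  have 7: "a q * P 2 (q - 1) - a q * (x * P 1 (q - 1) + a 1 * P 0 q
      + a (q - 1) * ?h * P 1 (q - 2)) = 0" (is "?e7 = 0")
    using x[of 1 "q - 1"] by (cases q) (auto simp: a_0 rec_x_def numeral_2_eq_2)
  have "A (P 0 (Suc q)) = A (y * P 0 q + a q * P 1 (q - 1))"
    using y[of 0 q] by (simp add: rec_y_def a_0)
  then have 8: "A (P 0 (Suc q)) - (y * A (P 0 q) + (1 - x * y) * P 0 q + a q * A (P 1 (q - 1))) = 0"
    (is "?e8 = 0")
    using lin(2) by (simp add: lin_op_def A_y)
  have "A (P 0 (Suc q)) - (- (l + ?q + 1) * P 1 (Suc q)
      + a (Suc q) * h (Suc q) * (- l - 2 * ?q) * P 0 q)
    = ?e8 + y * ?e1 + ?e2 + (l + ?q) * ?e3 - ?h * (2 - l - 2 * ?q) * ?e4 + x * ?e5 + ?e6 - ?e7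
      + P 0 q * (1 + (l + of_nat q) * a 1 * h (Suc q)
        + a q * (h q * (2 - l - 2 * of_nat q) + a 1 * (of_nat q - 2))
        + a (Suc q) * h (Suc q) * (1 + l + 2 * of_nat q))"
    by (simp add: algebra_simps)
  also have "\<dots> = 0"
    unfolding 1 2 3 4 5 6 7 8 a_h_0 by simp
  finally have "A (P 0 (Suc q)) = - (l + ?q + 1) * P 1 (Suc q)
      + a (Suc q) * h (Suc q) * (- l - 2 * ?q) * P 0 q"
    by (simp only: right_minus_eq)
  then show ?thesis
    by (simp add: A_rel_def a_0 algebra_simps)
qed

lemma A_rel_family:
  assumes "family P"
  shows "A_rel P p q"
proof (induction "p + q" arbitrary: p q rule: less_induct)
  case less
  consider "p = 0" "q = 0" | r where "p = Suc r" | r where "p = 0" "q = Suc r"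
    by (cases p; cases q) auto
  then show ?case
  proof cases
    case 1
    have "P 0 0 = 1" "rec_x P 0 0"
      using assms by (auto simp: family_def)
    then have "P 0 0 = 1" "P 1 0 = x"
      by (simp_all add: rec_x_def a_0)
    then show ?thesis
      using 1 by (simp add: A_rel_def A_1 a_0)
  next
    case 2
    then show ?thesis
      using A_rel_Suc_left[OF assms, of r q] less by simp
  next
    case 3
    then show ?thesis
      using A_rel_0_Suc[OF assms, of r] less by simp
  qed
qed

definition eig :: "nat \<Rightarrow> nat \<Rightarrow> 'a" where
  "eig p q = (l - 1) * (of_nat p + of_nat q) + of_nat p * of_nat p + of_nat q * of_nat q
     + of_nat p * of_nat q"

text \<open>Applying L to the x-recurrence brings in A P(p, q). Its coefficients are eigenvalue
  differences, so all contributions except that of P(p+1, q) cancel.\<close>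

lemma L_Suc_left:
  assumes P: "family P"
    and IH: "\<And>i j. i + j \<le> p + q \<Longrightarrow> L (P i j) = - eig i j * P i j"
  shows "L (P (Suc p) q) = - eig (Suc p) q * P (Suc p) q"
proof -
  let ?p = "of_nat p :: 'a" and ?q = "of_nat q :: 'a" and ?h = "h (p + q)"
  have x: "P (Suc p) q = x * P p q + a p * P (p - 1) (Suc q) + a q * ?h * P p (q - 1)"
    using P by (auto simp: family_def rec_x_def)
  then have 1: "P (Suc p) q - (x * P p q + a p * P (p - 1) (Suc q) + a q * ?h * P p (q - 1)) = 0"
    (is "?e1 = 0")
    by simp
  have 2: "A (P p q) - (- (l + 2 * ?p + ?q) * P (Suc p) q + a p * (1 - ?p + ?q) * P (p - 1) (Suc q)
      + a q * ?h * (2 - l - ?p - 2 * ?q) * P p (q - 1)) = 0" (is "?e2 = 0")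
    using A_rel_family[OF P, of p q] by (simp add: A_rel_def)
  \<comment> \<open>The bracket equals \<open>eig (p - 1) (q + 1)\<close>, and the one in the next
    fact \<open>eig p (q - 1)\<close>, rewritten relative to \<open>eig p q\<close>.\<close>
  have 3: "a p * L (P (p - 1) (Suc q)) + a p * (eig p q + 1 - ?p + ?q) * P (p - 1) (Suc q) = 0"
    (is "?e3 = 0")
    by (cases p) (simp_all add: a_0 IH eig_def algebra_simps)
  have 4: "a q * L (P p (q - 1)) + a q * (eig p q + 2 - l - ?p - 2 * ?q) * P p (q - 1) = 0"
    (is "?e4 = 0")
    by (cases q) (simp_all add: a_0 IH eig_def algebra_simps)
  have 5: "L (P p q) + eig p q * P p q = 0" (is "?e5 = 0")
    using IH[of p q] by simp
  have "L (P (Suc p) q) = L (x * P p q + a p * P (p - 1) (Suc q) + a q * (?h * P p (q - 1)))"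
    using x by (simp add: mult.assoc)
  then have 6: "L (P (Suc p) q) - (x * L (P p q) + A (P p q)
      + a p * L (P (p - 1) (Suc q)) + a q * ?h * L (P p (q - 1))) = 0" (is "?e6 = 0")
    using lin(1) by (simp add: lin_op_def L_x mult.assoc)
  have "L (P (Suc p) q) + (eig p q + l + 2 * ?p + ?q) * P (Suc p) q
    = ?e6 + x * ?e5 + ?e2 + ?e3 + ?h * ?e4 + eig p q * ?e1"
    by (simp add: algebra_simps)
  also have "\<dots> = 0"
    unfolding 1 2 3 4 5 6 by simp
  also have "eig p q + l + 2 * ?p + ?q = eig (Suc p) q"
    by (simp add: eig_def algebra_simps)
  finally show ?thesis
    by (simp add: add_eq_0_iff2)
qed

text \<open>Conjugation symmetry: every result on A and the x-recurrence yields one on B and the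
  y-recurrence for the transposed family.\<close>

lemma swap: "deltoid_ops l a h y x L B A"
  by unfold_locales (simp_all add: lin L_1 A_1 B_1 L_x L_y A_x A_y B_x B_y mult.commute[of y x])

lemma L_family:
  assumes "family P"
  shows "L (P p q) = - eig p q * P p q"
proof -
  interpret swap: deltoid_ops l a h y x L B A
    by (rule swap)
  have "swap.rec_x (\<lambda>p q. P q p) p q \<longleftrightarrow> rec_y P q p"
    and "swap.rec_y (\<lambda>p q. P q p) p q \<longleftrightarrow> rec_x P q p" for p q
    by (simp_all only: rec_x_def rec_y_def swap.rec_x_def swap.rec_y_def add.commute[of p q])
  then have swap_family: "swap.family (\<lambda>p q. P q p)"
    using assms by (simp add: family_def swap.family_def)
  have eig_commute: "eig i j = eig j i" for i j
    by (simp add: eig_def algebra_simps)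
  show ?thesis
  proof (induction "p + q" arbitrary: p q rule: less_induct)
    case less
    consider "p = 0" "q = 0" | r where "p = Suc r" | r where "p = 0" "q = Suc r"
      by (cases p; cases q) auto
    then show ?case
    proof cases
      case 1
      then show ?thesis
        using assms by (simp add: family_def L_1 eig_def)
    next
      case 2
      have "L (P i j) = - eig i j * P i j" if "i + j \<le> r + q" for i j
        using less[of i j] that 2 by simp
      from L_Suc_left[OF assms this] show ?thesis
        by (simp only: 2)
    next
      case 3
      \<comment> \<open>For p = 0 the last step must be a multiplication by y, which is the x-step
        of the transposed family at (r, 0).\<close>
      have "L (P j i) = - eig i j * P j i" if "i + j \<le> r + 0" for i j
        unfolding eig_commute[of i j] using less[of j i] that 3 by simp
      from swap.L_Suc_left[OF swap_family this] show ?thesis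
        by (simp only: 3 eig_commute[of 0 "Suc r"])
    qed
  qed
qed

end

section \<open>The coefficients\<close>

text \<open>Closed forms of the coefficients after cancelling the common factor \<open>l - 1\<close>.\<close>

definition a1_cf :: "real \<Rightarrow> nat \<Rightarrow> real" where
  "a1_cf l p = (if p = 0 then 0 else if p = 1 then - 2 / (l + 2)
     else - (real p * (3 * real p + 2 * l - 5)) / ((l + 3 * real p - 1) * (l + 3 * real p - 4)))"

definition h_cf :: "real \<Rightarrow> nat \<Rightarrow> real" where
  "h_cf l n = (if n = 1 then (l + 2) / (2 * (2 * l + 1))
     else (l + 3 * real n - 1) * (l + real n - 2)
       / ((2 * l + 3 * real n - 5) * (2 * l + 3 * real n - 2)))"

section \<open>Removal of the limits: the singularities at l = 1\<close>

text \<open>Evaluates the limits in \<open>a1\<close> and \<open>a2\<close>: the quotient agrees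
  near 1 with a closed form that is continuous there.\<close>

lemma Lim_shift_at_1:
  fixes f g :: "real \<Rightarrow> real"
  assumes "\<And>m. m > 0 \<Longrightarrow> m \<noteq> 1 \<Longrightarrow> f m = g m" and "isCont g 1"
  shows "Lim (at 0) (\<lambda>\<epsilon>. f (1 + \<epsilon>)) = g 1"
proof (rule tendsto_Lim)
  have "((\<lambda>\<epsilon>. g (1 + \<epsilon>)) \<longlongrightarrow> g 1) (at 0)"
    using assms(2) by (simp add: isCont_def LIM_offset_zero)
  \<comment> \<open>Radius 1 keeps \<open>1 + \<epsilon>\<close> positive, and the punctured
    neighbourhood avoids the value 1.\<close>
  moreover have "eventually (\<lambda>\<epsilon>. g (1 + \<epsilon>) = f (1 + \<epsilon>)) (at (0::real))"
    unfolding eventually_at by (rule exI[of _ 1]) (auto simp: dist_real_def assms(1))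
  ultimately show "((\<lambda>\<epsilon>. f (1 + \<epsilon>)) \<longlongrightarrow> g 1) (at 0)"
    by (rule Lim_transform_eventually)
qed simp

text \<open>Only p = 1 needs an argument: there both numerator and denominator contain
  \<open>l - 1\<close>.\<close>

lemma a1_generic:
  assumes "l > 0" "l \<noteq> 1"
  shows "a1_num l p / a1_den l p = a1_cf l p"
proof (cases "p = 1")
  case True
  have "(2 - 2 * l) / ((2 + l) * (l - 1)) = - 2 / (l + 2)"
    using assms by (subst frac_eq_eq) (simp_all, simp add: algebra_simps)
  then show ?thesis
    using True by (simp add: a1_num_def a1_den_def a1_cf_def)
qed (simp_all add: a1_num_def a1_den_def a1_cf_def)

lemma h_generic:
  assumes "l > 0" "l \<noteq> 1"
  shows "(l + 3 * real n - 1) * (l + real n - 2)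
    / ((2 * l + 3 * real n - 5) * (2 * l + 3 * real n - 2)) = h_cf l n"
proof (cases "n = 1")
  case True
  have "(2 + l) * (l - 1) / ((2 * l - 2) * (1 + 2 * l)) = (l + 2) / (2 * (2 * l + 1))"
    using assms by (simp add: frac_eq_eq) (simp add: algebra_simps)
  then show ?thesis
    using True by (simp add: h_cf_def)
qed (simp_all add: h_cf_def)

text \<open>A mere regrouping of factors. As division is total, it is also valid where denominators
  vanish, and it separates the dependence on q from that on p + q.\<close>

lemma a2_factor:
  "a2_num l p q / a2_den l p q = a1_num l q / a1_den l q
    * ((l + 3 * real (p + q) - 1) * (l + real (p + q) - 2)
      / ((2 * l + 3 * real (p + q) - 5) * (2 * l + 3 * real (p + q) - 2)))"
  by (simp add: a1_num_def a1_den_def a2_num_def a2_den_def mult_ac)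

lemma a2_generic:
  assumes "l > 0" "l \<noteq> 1"
  shows "a2_num l p q / a2_den l p q = a1_cf l q * h_cf l (p + q)"
  unfolding a2_factor a1_generic[OF assms] h_generic[OF assms] ..

lemma isCont_a1_cf: "l > 0 \<Longrightarrow> p \<noteq> 0 \<Longrightarrow> p = 1 \<or> l + 3 * real p \<noteq> 4 \<Longrightarrow> isCont (\<lambda>l. a1_cf l p) l"
  unfolding a1_cf_def by (cases "p = 1") (auto intro!: continuous_intros)

lemma isCont_h_cf: "l > 0 \<Longrightarrow> n \<noteq> 0 \<Longrightarrow> isCont (\<lambda>l. h_cf l n) l"
  unfolding h_cf_def by (cases "n = 1") (auto intro!: continuous_intros)

text \<open>For positive l and p the denominator vanishes only at l = p = 1, where the limit is the
  value of the closed form by continuity.\<close>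

lemma a1_eq:
  assumes "l > 0"
  shows "a1 l p = a1_cf l p"
proof (cases "p \<noteq> 0 \<and> a1_den l p = 0")
  case True
  then have p: "real p \<ge> 1"
    by simp
  with True assms have l: "l + 3 * real p = 4"
    by (auto simp: a1_den_def)
  with assms have "p = 1"
    using p by linarith
  with l have [simp]: "p = 1" "l = 1"
    by simp_all
  have "Lim (at 0) (\<lambda>\<epsilon>. a1_num (1 + \<epsilon>) 1 / a1_den (1 + \<epsilon>) 1) = a1_cf 1 1"
    using Lim_shift_at_1[of "\<lambda>l. a1_num l 1 / a1_den l 1" "\<lambda>l. a1_cf l 1"]
    by (simp add: a1_generic isCont_a1_cf)
  then show ?thesis
    using True by (simp add: a1_def)
next
  case False
  show ?thesis
  proof (cases "p = 0")
    case p: False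
    then have nz: "a1_den l p \<noteq> 0"
      using False by simp
    show ?thesis
    proof (cases "l = 1")
      case True
      then have "p \<noteq> 1"
        using nz by (auto simp: a1_den_def)
      then show ?thesis
        using p nz by (simp add: a1_def) (simp add: a1_num_def a1_den_def a1_cf_def)
    qed (use p nz assms in \<open>simp add: a1_def a1_generic\<close>)
  qed (simp add: a1_def a1_cf_def)
qed

text \<open>A zero of the denominator with q > 0 forces l = q = 1: either l + 3q = 4, or 2l + 3(p +
  q) = 5, which leaves p + q = 1. There p stays fixed and the limit is again taken by
  continuity.\<close>

lemma a2_eq:
  assumes "l > 0"
  shows "a2 l p q = a1_cf l q * h_cf l (p + q)"
proof (cases "q \<noteq> 0 \<and> a2_den l p q = 0")
  case True
  then have q: "real q \<ge> 1"
    by simp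
  with True assms have "l + 3 * real q = 4 \<or> 2 * l + 3 * (real p + real q) = 5"
    by (auto simp: a2_den_def)
  then have [simp]: "q = 1" "l = 1"
  proof -
    have "q = 1 \<and> l = 1" if "l + 3 * real q = 4"
    proof -
      have "q = 1"
        using that assms q by linarith
      then show ?thesis
        using that by simp
    qed
    moreover have "q = 1 \<and> l = 1" if *: "2 * l + 3 * (real p + real q) = 5"
    proof -
      have "real (p + q) < 2"
        using * assms by simp
      then have "p + q < 2"
        by linarith
      then show ?thesis
        using * q by (cases p) auto
    qed
    ultimately show "q = 1" "l = 1"
      using \<open>_ \<or> _\<close> by auto
  qed
  have "Lim (at 0) (\<lambda>\<epsilon>. a2_num (1 + \<epsilon>) p 1 / a2_den (1 + \<epsilon>) p 1) = a1_cf 1 1 * h_cf 1 (p + 1)"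
    using Lim_shift_at_1[of "\<lambda>l. a2_num l p 1 / a2_den l p 1" "\<lambda>l. a1_cf l 1 * h_cf l (p + 1)"]
    by (simp add: a2_generic isCont_a1_cf isCont_h_cf del: One_nat_def)
  then show ?thesis
    using True by (simp add: a2_def)
next
  case False
  show ?thesis
  proof (cases "q = 0")
    case q: False
    then have nz: "a2_den l p q \<noteq> 0"
      using False by simp
    show ?thesis
    proof (cases "l = 1")
      case True
      then have "q \<noteq> 1"
        using nz by (auto simp: a2_den_def)
      \<comment> \<open>Now l = 1 and q is at least 2, hence so is p + q, and both closed forms are
        in their general branch.\<close>
      then show ?thesis
        using q nz by (simp only: a2_def a2_factor)
          (simp add: a1_num_def a1_den_def a1_cf_def h_cf_def)
    qed (use q nz assms in \<open>simp add: a2_def a2_generic\<close>)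
  qed (simp add: a2_def a1_cf_def)
qed

section \<open>Recurrences and quadratic identities for the closed forms\<close>

text \<open>With S = l + 3p, each outer factor cancels one denominator; both products then have
  denominator 3(S - 1), and their numerators differ by 6(S - 1). The cases 0 and 1 meet the special
  branches of \<open>a1_cf\<close>.\<close>

lemma a1_cf_Suc:
  assumes "l > 0"
  shows "(l + 3 * real p + 2) * a1_cf l (Suc p) + 2 = (l + 3 * real p - 4) * a1_cf l p"
proof -
  consider "p = 0" | "p = 1" | "real p \<ge> 2"
    by linarith
  then show ?thesis
  proof cases
    case 3
    then have "l + 3 * real p + 2 \<noteq> 0" "l + 3 * real p - 1 \<noteq> 0" "l + 3 * real p - 4 \<noteq> 0"
      using assms by auto
    then show ?thesis
      using 3 by (auto simp: a1_cf_def divide_simps) (auto simp: algebra_simps)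
  qed (use assms in \<open>auto simp: a1_cf_def divide_simps; simp add: algebra_simps\<close>)+
qed

lemma h_cf_Suc:
  assumes "l > 0" "n > 0"
  shows "(2 * l + 3 * real n + 1) * h_cf l (Suc n) = 2 + (2 * l + 3 * real n - 5) * h_cf l n"
proof -
  consider "n = 1" | "real n \<ge> 2"
    using assms by linarith
  then show ?thesis
  proof cases
    case 1
    then show ?thesis
      using assms by (simp add: h_cf_def divide_simps) (simp add: algebra_simps)
  next
    case 2
    then have "2 * l + 3 * real n + 1 \<noteq> 0" "2 * l + 3 * real n - 5 \<noteq> 0" "2 * l + 3 * real n - 2 \<noteq> 0"
      using assms by auto
    then show ?thesis
      using 2 by (simp add: h_cf_def divide_simps) (simp add: algebra_simps)
  qed
qed

lemma a1_cf_alt: "l > 0 \<Longrightarrow> l \<noteq> 1 \<Longrightarrow>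
  a1_cf l p = - (real p * (3 * real p + 2 * l - 5)) / ((l + 3 * real p - 1) * (l + 3 * real p - 4))"
  by (simp add: a1_generic[symmetric] a1_num_def a1_den_def)

text \<open>Replacing the index by S = l + 3p makes the coefficients rational functions of real
  variables, in which passing to the next index is S + 3; the argument of \<open>h_cf\<close> then
  corresponds to a sum S + T.\<close>

lemma a1_cf_shift:
  assumes "l > 0" "l \<noteq> 1" and S: "S = l + 3 * real p"
  shows "a1_cf l p = - ((S - l) * (S + l - 5)) / (3 * (S - 1) * (S - 4))"
proof -
  have "S - l = 3 * real p" "S + l - 5 = 3 * real p + 2 * l - 5"
    using S by simp_all
  then show ?thesis
    unfolding a1_cf_alt[OF assms(1,2)] S[symmetric] by (simp only: mult.assoc) simp
qed

lemma a1_cf_Suc_shift: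
  assumes "l > 0" "l \<noteq> 1" and eq: "S = l + 3 * real p"
  shows "a1_cf l (Suc p) = - ((S + 3 - l) * (S + l - 2)) / (3 * (S + 2) * (S - 1))"
  using eq a1_cf_shift[OF assms(1,2), of "S + 3" "Suc p"] by (simp add: add_ac)

lemma h_cf_shift:
  assumes "l > 0" "l \<noteq> 1" and U: "U = 2 * l + 3 * real n"
  shows "h_cf l n = (U - l - 1) * (U + l - 6) / (3 * (U - 5) * (U - 2))"
proof -
  have "U - l - 1 = l + 3 * real n - 1" "U + l - 6 = 3 * (l + real n - 2)"
    using U by simp_all
  moreover have "a * b / (c * d) = a * (3 * b) / (3 * c * d)" for a b c d :: real
    by simp
  ultimately show ?thesis
    unfolding h_generic[OF assms(1,2), symmetric] U[symmetric] by (simp only:)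
qed

lemma h_cf_Suc_shift:
  assumes "l > 0" "l \<noteq> 1" and eq: "U = 2 * l + 3 * real n"
  shows "h_cf l (Suc n) = (U - l + 2) * (U + l - 3) / (3 * (U - 2) * (U + 1))"
  using eq h_cf_shift[OF assms(1,2), of "U + 3" "Suc n"] by (simp add: algebra_simps)

text \<open>With \<open>S = l + 3 * q\<close> and \<open>T = l + 3 * p\<close>, the differences \<open>b - a\<close> and \<open>a' - b'\<close> contain the
  factors \<open>S + T - 5\<close> and \<open>S + T + 1\<close> that cancel against the denominators of \<open>h\<close> and \<open>h'\<close>. The
  linear factors are made opaque to keep the clearing of denominators small.\<close>

lemma rational_identity:
  fixes S T l :: real
  assumes "S \<noteq> 1" "S \<noteq> 4" "S \<noteq> -2" "T \<noteq> 1" "T \<noteq> 4" "T \<noteq> -2"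
    "S + T \<noteq> 2" "S + T \<noteq> 5" "S + T \<noteq> -1"
  defines "b \<equiv> - ((S - l) * (S + l - 5)) / (3 * (S - 1) * (S - 4))"
    and "b' \<equiv> - ((S + 3 - l) * (S + l - 2)) / (3 * (S + 2) * (S - 1))"
    and "a \<equiv> - ((T - l) * (T + l - 5)) / (3 * (T - 1) * (T - 4))"
    and "a' \<equiv> - ((T + 3 - l) * (T + l - 2)) / (3 * (T + 2) * (T - 1))"
    and "h \<equiv> (S + T - l - 1) * (S + T + l - 6) / (3 * (S + T - 5) * (S + T - 2))"
    and "h' \<equiv> (S + T - l + 2) * (S + T + l - 3) / (3 * (S + T - 2) * (S + T + 1))"
  shows "b * h + a' * h' - a * b' = a * h + b' * h' - b * a'"
proof -
  define s1 s4 s2 t1 t4 t2 u2 u5 u1 where d: "s1 = S - 1" "s4 = S - 4" "s2 = S + 2"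
    "t1 = T - 1" "t4 = T - 4" "t2 = T + 2" "u2 = S + T - 2" "u5 = S + T - 5" "u1 = S + T + 1"
  have nz: "s1 \<noteq> 0" "s4 \<noteq> 0" "s2 \<noteq> 0" "t1 \<noteq> 0" "t4 \<noteq> 0" "t2 \<noteq> 0" "u2 \<noteq> 0" "u5 \<noteq> 0" "u1 \<noteq> 0"
    using assms(1-9) by (auto simp: d)
  have "b - a = ((T - l) * (T + l - 5) * (s1 * s4) - (S - l) * (S + l - 5) * (t1 * t4))
      / (3 * s1 * s4 * t1 * t4)"
    unfolding a_def b_def d[symmetric] using nz by (simp add: divide_simps)
  also have "(T - l) * (T + l - 5) * (s1 * s4) - (S - l) * (S + l - 5) * (t1 * t4)
      = (l - 1) * (l - 4) * (T - S) * u5"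
    unfolding d by algebra
  finally have 1: "b - a = (l - 1) * (l - 4) * (T - S) * u5 / (3 * s1 * s4 * t1 * t4)" .
  have "a' - b' = ((S + 3 - l) * (S + l - 2) * (t1 * t2) - (T + 3 - l) * (T + l - 2) * (s1 * s2))
      / (3 * s1 * s2 * t1 * t2)"
    unfolding a'_def b'_def d[symmetric] using nz by (simp add: divide_simps)
  also have "(S + 3 - l) * (S + l - 2) * (t1 * t2) - (T + 3 - l) * (T + l - 2) * (s1 * s2)
      = - (l - 1) * (l - 4) * (T - S) * u1"
    unfolding d by algebra
  finally have 2: "a' - b' = - (l - 1) * (l - 4) * (T - S) * u1 / (3 * s1 * s2 * t1 * t2)" .
  \<comment> \<open>Grouped this way, \<open>u5\<close> and \<open>u1\<close> cancel, and of the
    denominators of \<open>h\<close> and \<open>h'\<close> only the shared \<open>u2\<close>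
    survives besides numbers.\<close>
  have "(b - a) * h + (a' - b') * h' + b * a' - a * b'
    = ((l - 1) * (l - 4) * (T - S) * (S + T - l - 1) * (S + T + l - 6) * s2 * t2
      - (l - 1) * (l - 4) * (T - S) * (S + T - l + 2) * (S + T + l - 3) * s4 * t4
      + u2 * ((S - l) * (S + l - 5) * ((T + 3 - l) * (T + l - 2)) * s2 * t4
        - (T - l) * (T + l - 5) * ((S + 3 - l) * (S + l - 2)) * t2 * s4))
      / (9 * s1 * s2 * s4 * t1 * t2 * t4 * u2)"
    unfolding 1 2 unfolding a_def b_def a'_def b'_def h_def h'_def d[symmetric] using nz
    by (simp add: divide_simps) (simp add: algebra_simps)
  also have "\<dots> = 0"
  proof -
    have "(l - 1) * (l - 4) * (T - S) * (S + T - l - 1) * (S + T + l - 6) * s2 * t2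
      - (l - 1) * (l - 4) * (T - S) * (S + T - l + 2) * (S + T + l - 3) * s4 * t4
      + u2 * ((S - l) * (S + l - 5) * ((T + 3 - l) * (T + l - 2)) * s2 * t4
        - (T - l) * (T + l - 5) * ((S + 3 - l) * (S + l - 2)) * t2 * s4) = 0"
      unfolding d by algebra
    then show ?thesis
      by simp
  qed
  finally show ?thesis
    by (simp add: algebra_simps)
qed

text \<open>The boundary p = 0, that is T = l, where T may well be 4. Here \<open>a\<close> denotes
  the coefficient at index 1 in cancelled form, the one at index 0 being 0, and (S - l)/3 is
  q.\<close>

lemma rational_identity_0:
  fixes S l :: real
  assumes "S \<noteq> 1" "S \<noteq> 4" "S \<noteq> -2" "l \<noteq> -2" "S + l \<noteq> 2" "S + l \<noteq> 5" "S + l \<noteq> -1"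
  defines "b \<equiv> - ((S - l) * (S + l - 5)) / (3 * (S - 1) * (S - 4))"
    and "b' \<equiv> - ((S + 3 - l) * (S + l - 2)) / (3 * (S + 2) * (S - 1))"
    and "a \<equiv> - 2 / (l + 2)"
    and "h \<equiv> (S - 1) * (S + 2 * l - 6) / (3 * (S + l - 5) * (S + l - 2))"
    and "h' \<equiv> (S + 2) * (S + 2 * l - 3) / (3 * (S + l - 2) * (S + l + 1))"
  shows "b * h + a * h' = b' * h' - b * a"
    and "1 + (l + (S - l) / 3) * a * h' + b * (h * (2 - l - 2 * ((S - l) / 3)) + a * ((S - l) / 3 - 2))
      + b' * h' * (1 + l + 2 * ((S - l) / 3)) = 0"
proof -
  define s1 s4 s2 u2 u5 u1 l2 where d: "s1 = S - 1" "s4 = S - 4" "s2 = S + 2"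
    "u2 = S + l - 2" "u5 = S + l - 5" "u1 = S + l + 1" "l2 = l + 2"
  have nz: "s1 \<noteq> 0" "s4 \<noteq> 0" "s2 \<noteq> 0" "u2 \<noteq> 0" "u5 \<noteq> 0" "u1 \<noteq> 0" "l2 \<noteq> 0"
    using assms(1-7) by (auto simp: d)
  show "b * h + a * h' = b' * h' - b * a"
    unfolding a_def b_def b'_def h_def h'_def d[symmetric] using nz
    by (simp add: divide_simps) (unfold d, algebra)
  show "1 + (l + (S - l) / 3) * a * h' + b * (h * (2 - l - 2 * ((S - l) / 3)) + a * ((S - l) / 3 - 2))
      + b' * h' * (1 + l + 2 * ((S - l) / 3)) = 0"
    unfolding a_def b_def b'_def h_def h'_def d[symmetric] using nz
    by (simp add: divide_simps) (unfold d, algebra)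
qed

lemma denominators_nonzero:
  assumes "l > 0" "l \<noteq> 1" "p > 0"
  shows "l + 3 * real p \<noteq> 1" "l + 3 * real p \<noteq> 4" "l + 3 * real p \<noteq> -2"
    "2 * l + 3 * real p \<noteq> 5" "2 * l + 3 * real p \<noteq> 2" "2 * l + 3 * real p \<noteq> -1"
proof -
  have "p = 1 \<or> real p \<ge> 2"
    using assms by linarith
  then show "l + 3 * real p \<noteq> 1" "l + 3 * real p \<noteq> 4" "l + 3 * real p \<noteq> -2"
    "2 * l + 3 * real p \<noteq> 5" "2 * l + 3 * real p \<noteq> 2" "2 * l + 3 * real p \<noteq> -1"
    using assms by auto
qed

lemma identities_at_0:
  assumes l: "l > 0" "l \<noteq> 1" and q: "q > 0"
  shows "a1_cf l q * h_cf l q + a1_cf l 1 * h_cf l (Suc q)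
      = a1_cf l (Suc q) * h_cf l (Suc q) - a1_cf l q * a1_cf l 1"
    and "1 + (l + real q) * a1_cf l 1 * h_cf l (Suc q)
      + a1_cf l q * (h_cf l q * (2 - l - 2 * real q) + a1_cf l 1 * (real q - 2))
      + a1_cf l (Suc q) * h_cf l (Suc q) * (1 + l + 2 * real q) = 0"
proof -
  define S where "S = l + 3 * real q"
  have U: "S + l = 2 * l + 3 * real q"
    by (simp add: S_def)
  have S: "S \<noteq> 1" "S \<noteq> 4" "S \<noteq> -2" "l \<noteq> -2" "S + l \<noteq> 2" "S + l \<noteq> 5" "S + l \<noteq> -1"
    using denominators_nonzero[OF l q] l unfolding U by (auto simp: S_def)
  have a1: "a1_cf l 1 = - 2 / (l + 2)"
    by (simp add: a1_cf_def)
  have h: "h_cf l q = (S - 1) * (S + 2 * l - 6) / (3 * (S + l - 5) * (S + l - 2))"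
    "h_cf l (Suc q) = (S + 2) * (S + 2 * l - 3) / (3 * (S + l - 2) * (S + l + 1))"
    unfolding h_cf_shift[OF l U] h_cf_Suc_shift[OF l U] by (simp_all add: add_ac)
  have q: "real q = (S - l) / 3"
    by (simp add: S_def)
  show "a1_cf l q * h_cf l q + a1_cf l 1 * h_cf l (Suc q)
      = a1_cf l (Suc q) * h_cf l (Suc q) - a1_cf l q * a1_cf l 1"
    unfolding h a1 a1_cf_shift[OF l S_def] a1_cf_Suc_shift[OF l S_def]
    by (rule rational_identity_0[OF S])
  show "1 + (l + real q) * a1_cf l 1 * h_cf l (Suc q)
      + a1_cf l q * (h_cf l q * (2 - l - 2 * real q) + a1_cf l 1 * (real q - 2))
      + a1_cf l (Suc q) * h_cf l (Suc q) * (1 + l + 2 * real q) = 0"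
    unfolding h a1 a1_cf_shift[OF l S_def] a1_cf_Suc_shift[OF l S_def] q
    by (rule rational_identity_0[OF S])
qed

lemma a1_cf_1: "a1_cf 1 p = (if p = 0 then 0 else if p = 1 then - 2 / 3 else - 1 / 3)"
proof -
  consider "p = 0" | "p = 1" | "real p \<ge> 2"
    by linarith
  then show ?thesis
    by cases (auto simp: a1_cf_def divide_simps algebra_simps)
qed

lemma h_cf_1: "h_cf 1 n = (if n = 0 then 0 else if n = 1 then 1 / 2 else 1 / 3)"
proof -
  consider "n = 0" | "n = 1" | "real n \<ge> 2"
    by linarith
  then show ?thesis
    by cases (auto simp: h_cf_def divide_simps algebra_simps)
qed

text \<open>The identity is symmetric in p and q, so one boundary lemma serves both p = 0 and q = 0;
  the interior is \<open>rational_identity\<close>.\<close>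

lemma a1_cf_h_cf:
  assumes "l > 0"
  shows "a1_cf l q * h_cf l (p + q) + a1_cf l (Suc p) * h_cf l (Suc (p + q))
      - a1_cf l p * a1_cf l (Suc q)
    = a1_cf l p * h_cf l (p + q) + a1_cf l (Suc q) * h_cf l (Suc (p + q))
      - a1_cf l q * a1_cf l (Suc p)"
proof (cases "l = 1")
  case True
  then show ?thesis
    by (auto simp: a1_cf_1 h_cf_1)
next
  case l: False
  consider "p = 0" "q = 0" | "p = 0" "q > 0" | "q = 0" "p > 0" | "p > 0" "q > 0"
    by auto
  then show ?thesis
  proof cases
    case 2
    then show ?thesis
      using identities_at_0(1)[OF assms l, of q] by (simp add: a1_cf_def[of l 0])
  next
    case 3
    then show ?thesis
      using identities_at_0(1)[OF assms l, of p] by (simp add: a1_cf_def[of l 0])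
  next
    case 4
    define S T where S: "S = l + 3 * real q" and T: "T = l + 3 * real p"
    have U: "S + T = 2 * l + 3 * real (p + q)"
      by (simp add: S T)
    have nz: "S \<noteq> 1" "S \<noteq> 4" "S \<noteq> -2" "T \<noteq> 1" "T \<noteq> 4" "T \<noteq> -2"
      "S + T \<noteq> 2" "S + T \<noteq> 5" "S + T \<noteq> -1"
      unfolding U using 4 denominators_nonzero[OF assms l] by (simp_all add: S T del: of_nat_add)
    show ?thesis
      unfolding h_cf_shift[OF assms l U] h_cf_Suc_shift[OF assms l U] a1_cf_shift[OF assms l S]
        a1_cf_Suc_shift[OF assms l S] a1_cf_shift[OF assms l T] a1_cf_Suc_shift[OF assms l T]
      by (rule rational_identity[OF nz])
  qed simp
qed

lemma a1_cf_h_cf_0: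
  assumes "l > 0"
  shows "1 + (l + real q) * a1_cf l 1 * h_cf l (Suc q)
      + a1_cf l q * (h_cf l q * (2 - l - 2 * real q) + a1_cf l 1 * (real q - 2))
      + a1_cf l (Suc q) * h_cf l (Suc q) * (1 + l + 2 * real q) = 0"
proof -
  consider "q = 0" | "l = 1" "q > 0" | "l \<noteq> 1" "q > 0"
    by auto
  then show ?thesis
  proof cases
    case 1
    then show ?thesis
      using assms by (simp add: a1_cf_def h_cf_def divide_simps) (simp add: algebra_simps)
  next
    case 2
    then show ?thesis
      by (auto simp: a1_cf_1 h_cf_1 field_simps)
  next
    case 3
    then show ?thesis
      using identities_at_0(2)[OF assms] by blast
  qed
qed

section \<open>The differential operators\<close>

text \<open>Embeds the scalars as a ring homomorphism, turning \<open>scale\<close> into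
  multiplication as the abstract setting requires.\<close>

definition const :: "real \<Rightarrow> real poly poly" where
  "const c = [:[:c:]:]"

lemma const_simps:
  "const 0 = 0" "const 1 = 1" "const (numeral k) = numeral k" "const (of_nat n) = of_nat n"
  "const (b + c) = const b + const c" "const (b - c) = const b - const c"
  "const (b * c) = const b * const c" "const (- c) = - const c"
  by (simp_all add: const_def one_pCons numeral_poly of_nat_poly)

lemma scale_eq_const: "scale c f = const c * f"
  by (simp add: scale_def const_def)

lemma dZ_simps:
  "dZ 0 = 0" "dZ 1 = 0" "dZ (f + g) = dZ f + dZ g" "dZ (const c * f) = const c * dZ f"
  "dZ (Z * f) = f + Z * dZ f" "dZ (Zb * f) = Zb * dZ f"
  by (simp_all add: dZ_def const_def Z_def Zb_def pderiv_add pderiv_smult pderiv_pCons)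

lemma coeff_dZb: "coeff (dZb f) n = pderiv (coeff f n)"
  by (simp add: dZb_def coeff_map_poly)

lemma dZb_simps:
  "dZb 0 = 0" "dZb 1 = 0" "dZb (f + g) = dZb f + dZb g" "dZb (const c * f) = const c * dZb f"
  "dZb (Z * f) = Z * dZb f" "dZb (Zb * f) = f + Zb * dZb f"
  by (rule poly_eqI, simp add: coeff_dZb const_def Z_def Zb_def pderiv_add pderiv_smult
      pderiv_mult pderiv_pCons coeff_pCons one_pCons split: nat.split)+

text \<open>The commutator of \<open>L\<close> with multiplication by \<open>Z\<close>, computed
  from the product rule; \<open>AZb\<close> is its conjugate.\<close>

definition AZ :: "real \<Rightarrow> real poly poly \<Rightarrow> real poly poly" where
  "AZ l f = 2 * (Zb - Z * Z) * dZ f + (1 - Z * Zb) * dZb f - const l * Z * f"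

definition AZb :: "real \<Rightarrow> real poly poly \<Rightarrow> real poly poly" where
  "AZb l f = (1 - Z * Zb) * dZ f + 2 * (Z - Zb * Zb) * dZb f - const l * Zb * f"

text \<open>Each axiom is the image of a real identity under the homomorphism
  \<open>const\<close>.\<close>

lemma deltoid_coeffs_const:
  assumes "l > 0"
  shows "deltoid_coeffs (const l) (\<lambda>p. const (a1_cf l p)) (\<lambda>n. const (h_cf l n))"
proof
  show "const (a1_cf l 0) = 0"
    by (simp add: a1_cf_def const_simps)
next
  fix p
  show "(const l + 3 * of_nat p + 2) * const (a1_cf l (Suc p)) + 2
      = (const l + 3 * of_nat p - 4) * const (a1_cf l p)"
    using arg_cong[OF a1_cf_Suc[OF assms, of p], of const] by (simp only: const_simps)
next
  fix n :: nat
  assume "n > 0"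
  then show "(2 * const l + 3 * of_nat n + 1) * const (h_cf l (Suc n))
      = 2 + (2 * const l + 3 * of_nat n - 5) * const (h_cf l n)"
    using arg_cong[OF h_cf_Suc[OF assms, of n], of const] by (simp only: const_simps)
next
  fix p q
  show "const (a1_cf l q) * const (h_cf l (p + q)) + const (a1_cf l (Suc p)) * const (h_cf l (Suc (p + q)))
      - const (a1_cf l p) * const (a1_cf l (Suc q))
    = const (a1_cf l p) * const (h_cf l (p + q)) + const (a1_cf l (Suc q)) * const (h_cf l (Suc (p + q)))
      - const (a1_cf l q) * const (a1_cf l (Suc p))"
    using arg_cong[OF a1_cf_h_cf[OF assms, of q p], of const] by (simp only: const_simps)
next
  fix q
  show "1 + (const l + of_nat q) * const (a1_cf l 1) * const (h_cf l (Suc q))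
      + const (a1_cf l q) * (const (h_cf l q) * (2 - const l - 2 * of_nat q)
        + const (a1_cf l 1) * (of_nat q - 2))
      + const (a1_cf l (Suc q)) * const (h_cf l (Suc q)) * (1 + const l + 2 * of_nat q) = 0"
    using arg_cong[OF a1_cf_h_cf_0[OF assms, of q], of const] by (simp only: const_simps)
qed

lemma L_simps:
  "L \<alpha> 1 = 0" "L \<alpha> (f + g) = L \<alpha> f + L \<alpha> g" "L \<alpha> (const c * f) = const c * L \<alpha> f"
  "L \<alpha> (Z * f) = Z * L \<alpha> f + AZ (lam \<alpha>) f"
  "L \<alpha> (Zb * f) = Zb * L \<alpha> f + AZb (lam \<alpha>) f"
  by (simp_all only: L_def AZ_def AZb_def dZ_simps dZb_simps scale_eq_const power2_eq_square)
    (simp_all add: algebra_simps)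

lemma AZ_simps:
  "AZ l 1 = - const l * Z" "AZ l (f + g) = AZ l f + AZ l g" "AZ l (const c * f) = const c * AZ l f"
  "AZ l (Z * f) = Z * AZ l f + 2 * (Zb - Z * Z) * f"
  "AZ l (Zb * f) = Zb * AZ l f + (1 - Z * Zb) * f"
  by (simp_all only: AZ_def dZ_simps dZb_simps) (simp_all add: algebra_simps)

lemma AZb_simps:
  "AZb l 1 = - const l * Zb" "AZb l (f + g) = AZb l f + AZb l g"
  "AZb l (const c * f) = const c * AZb l f"
  "AZb l (Z * f) = Z * AZb l f + (1 - Z * Zb) * f"
  "AZb l (Zb * f) = Zb * AZb l f + 2 * (Z - Zb * Zb) * f"
  by (simp_all only: AZb_def dZ_simps dZb_simps) (simp_all add: algebra_simps)

theorem theorem6p3: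
  fixes \<alpha> :: real
  assumes "\<alpha> > - 5 / 6"
  shows "(\<exists>!P. recurrence_family (lam \<alpha>) P) \<and>
    (\<forall>P. recurrence_family (lam \<alpha>) P \<longrightarrow>
      (\<forall>p q. L \<alpha> (P p q) = - scale (eigval (lam \<alpha>) p q) (P p q)))"
proof -
  define l where "l = lam \<alpha>"
  have l: "l > 0"
    using assms by (simp add: l_def lam_def)
  interpret deltoid_coeffs "const l" "\<lambda>p. const (a1_cf l p)" "\<lambda>n. const (h_cf l n)"
    by (rule deltoid_coeffs_const[OF l])
  interpret deltoid_recurrence "const l" "\<lambda>p. const (a1_cf l p)" "\<lambda>n. const (h_cf l n)" Z Zb ..
  interpret deltoid_ops "const l" "\<lambda>p. const (a1_cf l p)" "\<lambda>n. const (h_cf l n)" Z Zb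
    "L \<alpha>" "AZ l" "AZb l"
    by unfold_locales (simp_all add: lin_op_def L_simps[of \<alpha>, folded l_def] AZ_simps AZb_simps)
  have rec: "rec_x P p q \<longleftrightarrow> P (p + 1) q = Z * P p q + scale (a1 l p) (P (p - 1) (q + 1))
      + scale (a2 l p q) (P p (q - 1))"
    "rec_y P p q \<longleftrightarrow> P p (q + 1) = Zb * P p q + scale (a1 l q) (P (p + 1) (q - 1))
      + scale (a2 l q p) (P (p - 1) q)" for P p q
    by (simp_all only: rec_x_def rec_y_def scale_eq_const a1_eq[OF l] a2_eq[OF l] const_simps
        Suc_eq_plus1 add.commute[of q p])
  \<comment> \<open>The recurrences at (0, 0) give the values of degree 1 because
    \<open>a 0 = 0\<close>; thus the concrete and the abstract notion of family coincide.\<close>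
  have "P 1 0 = Z" "P 0 1 = Zb" if "family P" for P
  proof -
    have "P 0 0 = 1" "rec_x P 0 0" "rec_y P 0 0"
      using that by (simp_all add: family_def)
    then show "P 1 0 = Z" "P 0 1 = Zb"
      by (simp_all add: rec_x_def rec_y_def a_0)
  qed
  then have rec_iff: "recurrence_family l P \<longleftrightarrow> family P" for P
    unfolding recurrence_family_def rec[symmetric] family_def by blast
  have "\<exists>!P. family P"
    by (rule ex1I[of _ fam], rule family_fam) (intro ext family_unique)
  moreover have "eig p q = const (eigval l p q)" for p q
    by (simp add: eig_def eigval_def const_simps power2_eq_square)
  ultimately show ?thesis
    using L_family unfolding l_def[symmetric] rec_iff by (simp add: scale_eq_const)
qed

end
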